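(* For every $n$ and every partial recursive function $f:\mathbb{N}^n\rightharpoonup\mathbb{N}$, there exists a program $P$ of Stateful Processes whose network is well-formed and which implements $f$ with input processes $1,\dots,n$ and output process $0$.
   Context: Stateful Processes (SP), instantiated with process names and values being natural numbers, expressions being zero, a variable, or the successor of a variable, and Boolean expressions testing equality of two local variables. A behaviour is $B ::= p!e;B \mid p?x;B \mid p\oplus l;B \mid p\,\&\,mB_1 /\!/ mB_2 \mid \mathtt{If}\ b\ \mathtt{Then}\ B_1\ \mathtt{Else}\ B_2 \mid \mathtt{Call}\ X \mid \mathtt{End}$, with $l\in\{\mathtt{left},\mathtt{right}\}$ and $mB_i\in\{\mathrm{None}\}\cup\{\mathrm{Some}\ B\}$ the behaviour offered on receiving left/right. A network maps each process to a behaviour; a program is a pair of procedure definitions (mapping procedure names to behaviours) and a network. States map (process, variable) to values. Semantics (labelled transitions on (program, state)): if $p$ has $q!e;B$ and $q$ has $p?x;B'$, they synchronise, $q$'s variable $x$ is set to the value of $e$ at $p$, and they continue as $B,B'$; if $p$ has $q\oplus l;B$ and $q$ has a branching on $p$ offering Some $B_l$ for $l$, they continue as $B, B_l$; a conditional at $p$ continues with the branch selected by evaluating $b$ at $p$; procedure calls are unfolded from the definitions. Network_WF is the standard syntactic well-formedness of networks (e.g. no process addresses itself). A program terminates when all processes reach End. $P$ implements $f$ with inputs $ps_1,\dots,ps_m$ and output $q$ iff for every state $s$ in which each $ps_i$ stores $n_i$ in its variable $x$: (i) if $f(n_1,\dots,n_m)=n$, then all executions of $P$ from $s$ terminate, in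 a state where $q$ stores $n$ in $x$; (ii) if $f(n_1,\dots,n_m)$ is undefined, no execution of $P$ from $s$ terminates. *)

theory Defs
  imports Main "HOL-Library.Finite_Map"
begin

section \<open>Stateful Processes\<close>

type_synonym pid = nat
type_synonym val = nat
type_synonym proc_name = nat

datatype 'v expr = Zero | Var 'v | SucVar 'v

datatype 'v bexpr = Eq 'v 'v

datatype branch_label = Left | Right

datatype 'v behaviour =
    Send pid "'v expr" "'v behaviour"
  | Recv pid 'v "'v behaviour"
  | Select pid branch_label "'v behaviour"
  | Branch pid "'v behaviour option" "'v behaviour option"
  | Cond "'v bexpr" "'v behaviour" "'v behaviour"
  | Call proc_name
  | End

type_synonym 'v network = "pid \<Rightarrow> 'v behaviour"

text \<open>Programs are finite syntactic objects: with infinitely many procedure definitions, every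
  function whatsoever could be implemented by a lookup table.\<close>

type_synonym 'v proc_defs = "(proc_name, 'v behaviour) fmap"
type_synonym 'v program = "'v proc_defs \<times> 'v network"
type_synonym 'v state = "pid \<Rightarrow> 'v \<Rightarrow> val"
type_synonym 'v config = "'v program \<times> 'v state"

fun eval_expr :: "'v expr \<Rightarrow> ('v \<Rightarrow> val) \<Rightarrow> val" where
  "eval_expr Zero \<sigma> = 0"
| "eval_expr (Var v) \<sigma> = \<sigma> v"
| "eval_expr (SucVar v) \<sigma> = Suc (\<sigma> v)"

fun eval_bexpr :: "'v bexpr \<Rightarrow> ('v \<Rightarrow> val) \<Rightarrow> bool" where
  "eval_bexpr (Eq v w) \<sigma> \<longleftrightarrow> \<sigma> v = \<sigma> w"

fun offer :: "branch_label \<Rightarrow> 'a option \<Rightarrow> 'a option \<Rightarrow> 'a option" where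
  "offer Left mB1 mB2 = mB1"
| "offer Right mB1 mB2 = mB2"

text \<open>\<open>behaviour_wf p B\<close>: process \<open>p\<close> is not addressed by any action in \<open>B\<close>.\<close>

fun behaviour_wf :: "pid \<Rightarrow> 'v behaviour \<Rightarrow> bool" where
  "behaviour_wf p (Send q e B) \<longleftrightarrow> q \<noteq> p \<and> behaviour_wf p B"
| "behaviour_wf p (Recv q v B) \<longleftrightarrow> q \<noteq> p \<and> behaviour_wf p B"
| "behaviour_wf p (Select q l B) \<longleftrightarrow> q \<noteq> p \<and> behaviour_wf p B"
| "behaviour_wf p (Branch q mB1 mB2) \<longleftrightarrow>
     q \<noteq> p \<and> pred_option (behaviour_wf p) mB1 \<and> pred_option (behaviour_wf p) mB2"
| "behaviour_wf p (Cond b B1 B2) \<longleftrightarrow> behaviour_wf p B1 \<and> behaviour_wf p B2"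
| "behaviour_wf p (Call X) \<longleftrightarrow> True"
| "behaviour_wf p End \<longleftrightarrow> True"

definition network_wf :: "'v network \<Rightarrow> bool" where
  "network_wf N \<longleftrightarrow> (\<forall>p. behaviour_wf p (N p))"

datatype trans_label =
    L_Com pid val pid
  | L_Sel pid pid branch_label
  | L_Tau pid

inductive sp_step :: "'v config \<Rightarrow> trans_label \<Rightarrow> 'v config \<Rightarrow> bool" where
  S_Com: "\<lbrakk>N p = Send q e B; N q = Recv p v B'; a = eval_expr e (s p)\<rbrakk> \<Longrightarrow>
    sp_step ((D, N), s) (L_Com p a q) ((D, N(p := B, q := B')), s(q := (s q)(v := a)))"
| S_Sel: "\<lbrakk>N p = Select q l B; N q = Branch p mB1 mB2; offer l mB1 mB2 = Some B'\<rbrakk> \<Longrightarrow>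
    sp_step ((D, N), s) (L_Sel p q l) ((D, N(p := B, q := B')), s)"
| S_Then: "\<lbrakk>N p = Cond b B1 B2; eval_bexpr b (s p)\<rbrakk> \<Longrightarrow>
    sp_step ((D, N), s) (L_Tau p) ((D, N(p := B1)), s)"
| S_Else: "\<lbrakk>N p = Cond b B1 B2; \<not> eval_bexpr b (s p)\<rbrakk> \<Longrightarrow>
    sp_step ((D, N), s) (L_Tau p) ((D, N(p := B2)), s)"
| S_Call: "\<lbrakk>N p = Call X; fmlookup D X = Some B\<rbrakk> \<Longrightarrow>
    sp_step ((D, N), s) (L_Tau p) ((D, N(p := B)), s)"

definition sp_reduces :: "'v config \<Rightarrow> 'v config \<Rightarrow> bool" where
  "sp_reduces c c' \<longleftrightarrow> (\<exists>l. sp_step c l c')"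

definition terminated :: "'v config \<Rightarrow> bool" where
  "terminated c \<longleftrightarrow> (\<forall>p. snd (fst c) p = End)"

text \<open>All executions from \<open>c\<close> terminate in a state satisfying \<open>Q\<close>: there is no infinite
  execution, and an execution that cannot be prolonged is not deadlocked, but has all processes
  at \<open>End\<close>, in a state satisfying \<open>Q\<close>.\<close>

definition all_executions_terminate_in :: "'v config \<Rightarrow> ('v state \<Rightarrow> bool) \<Rightarrow> bool" where
  "all_executions_terminate_in c Q \<longleftrightarrow>
     (\<nexists>r :: nat \<Rightarrow> 'v config. r 0 = c \<and> (\<forall>i. sp_reduces (r i) (r (Suc i)))) \<and>
     (\<forall>c'. sp_reduces\<^sup>*\<^sup>* c c' \<and> (\<nexists>c''. sp_reduces c' c'') \<longrightarrow> terminated c' \<and> Q (snd c'))"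

definition no_execution_terminates :: "'v config \<Rightarrow> bool" where
  "no_execution_terminates c \<longleftrightarrow> (\<nexists>c'. sp_reduces\<^sup>*\<^sup>* c c' \<and> terminated c')"

definition implements ::
  "'v \<Rightarrow> 'v program \<Rightarrow> (nat list \<Rightarrow> nat option) \<Rightarrow> pid list \<Rightarrow> pid \<Rightarrow> bool" where
  "implements x P f ps q \<longleftrightarrow>
     (\<forall>s ns. length ns = length ps \<and> (\<forall>i < length ps. s (ps ! i) x = ns ! i) \<longrightarrow>
        (case f ns of
           Some m \<Rightarrow> all_executions_terminate_in (P, s) (\<lambda>s'. s' q x = m)
         | None \<Rightarrow> no_execution_terminates (P, s)))"


section \<open>Partial recursive functions\<close>

text \<open>A partial function on \<open>n\<close>-tuples of natural numbers is represented by a function on lists,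
  of which only the values on lists of length \<open>n\<close> matter; \<open>None\<close> stands for undefinedness.\<close>

type_synonym pfun = "nat list \<Rightarrow> nat option"

text \<open>Strict composition: defined only if all the inner functions are.\<close>

definition pf_comp :: "pfun \<Rightarrow> pfun list \<Rightarrow> pfun" where
  "pf_comp g hs = (\<lambda>xs. Option.bind (those (map (\<lambda>h. h xs) hs)) g)"

fun pf_rec_at :: "pfun \<Rightarrow> pfun \<Rightarrow> nat \<Rightarrow> pfun" where
  "pf_rec_at g h 0 xs = g xs"
| "pf_rec_at g h (Suc k) xs = Option.bind (pf_rec_at g h k xs) (\<lambda>r. h (k # r # xs))"

definition pf_rec :: "pfun \<Rightarrow> pfun \<Rightarrow> pfun" where
  "pf_rec g h = (\<lambda>xs. pf_rec_at g h (hd xs) (tl xs))"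

definition is_mu :: "pfun \<Rightarrow> nat list \<Rightarrow> nat \<Rightarrow> bool" where
  "is_mu h xs k \<longleftrightarrow> h (k # xs) = Some 0 \<and> (\<forall>i < k. \<exists>r > 0. h (i # xs) = Some r)"

definition pf_mu :: "pfun \<Rightarrow> pfun" where
  "pf_mu h = (\<lambda>xs. if \<exists>k. is_mu h xs k then Some (THE k. is_mu h xs k) else None)"

inductive partial_recursive :: "nat \<Rightarrow> pfun \<Rightarrow> bool" where
  zero: "partial_recursive n (\<lambda>xs. Some 0)"
| succ: "partial_recursive 1 (\<lambda>xs. Some (Suc (hd xs)))"
| proj: "i < n \<Longrightarrow> partial_recursive n (\<lambda>xs. Some (xs ! i))"
| comp: "\<lbrakk>partial_recursive (length hs) g; \<forall>h \<in> set hs. partial_recursive n h\<rbrakk> \<Longrightarrow>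
    partial_recursive n (pf_comp g hs)"
| prec: "\<lbrakk>partial_recursive n g; partial_recursive (n + 2) h\<rbrakk> \<Longrightarrow>
    partial_recursive (n + 1) (pf_rec g h)"
| mu: "partial_recursive (n + 1) h \<Longrightarrow> partial_recursive n (pf_mu h)"
| cong: "\<lbrakk>partial_recursive n f; \<forall>xs. length xs = n \<longrightarrow> f' xs = f xs\<rbrakk> \<Longrightarrow> partial_recursive n f'"

end

theory Submission
  imports Defs
begin

text \<open>A single controller process runs a sequential register program; every other process it uses is
  a register, running one and the same server loop that can be read, written and shut down by the
  controller. The reduction relation has the strict diamond property, since two distinct enabled
  transitions have disjoint participants; hence all maximal executions have the same length and the
  same final configuration, and it is enough to follow one schedule. Partial recursive functions are
  then compiled to register programs built from assignments, sequencing and loops.\<close>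

section \<open>Confluence of the semantics\<close>

text \<open>Behaviours have no sequential composition, so code is compiled in continuation-passing
  style: a fragment is built for a given continuation \<open>K\<close> and ends by becoming
  \<open>K\<close>. Only loops need procedures: the body of the procedure tests two registers for
  equality and proceeds to the exit continuation or to the loop body, which ends by calling the
  procedure again. Hence procedure names must be chosen fresh. Termination asks every process to
  reach \<open>End\<close>, which a server never does by itself. So the finite set of registers in
  use is collected, all other processes except the controller start at \<open>End\<close>, and the
  last continuation shuts the registers down. The controller needs two variables because
  \<open>Eq\<close> compares variables of a single process; a register only uses \<open>x\<close>.
  Undefinedness shows as a loop that is never left. That no execution at all terminates then follows
  by induction on the length of a supposed terminating one, which confluence makes independent of
  the schedule.\<close>

fun participants :: "trans_label \<Rightarrow> pid set" where
  "participants (L_Com p a q) = {p, q}"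
| "participants (L_Sel p q l) = {p, q}"
| "participants (L_Tau p) = {p}"

lemma sp_step_local:
  assumes "sp_step ((D, N), s) l ((D', N'), s')"
  shows "D' = D"
    and "p \<notin> participants l \<Longrightarrow> N' p = N p"
    and "p \<notin> participants l \<Longrightarrow> s' p = s p"
  using assms by (auto elim!: sp_step.cases)

text \<open>Each rule reads and changes only the behaviours and stores of its participants, so the
  same step can be replayed in any configuration that agrees with the old one there.
  \<open>override_on\<close> describes the result uniformly for all rules.\<close>

lemma sp_step_transfer:
  assumes "sp_step ((D, N), s) l ((D', N'), s')"
    and N: "\<And>p. p \<in> participants l \<Longrightarrow> N2 p = N p"
    and s: "\<And>p. p \<in> participants l \<Longrightarrow> s2 p = s p"
  shows "sp_step ((D, N2), s2) l
    ((D, override_on N2 N' (participants l)), override_on s2 s' (participants l))"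
  using assms(1)
proof cases
  case (S_Com p q e B v B' a)
  have "override_on N2 N' (participants l) = N2(p := B, q := B')"
    "override_on s2 s' (participants l) = s2(q := (s2 q)(v := a))"
    using S_Com N s by (auto simp: override_on_def fun_eq_iff)
  then show ?thesis
    using sp_step.S_Com[of N2 p q e B v B' a s2 D] S_Com N s by auto
next
  case (S_Sel p q k B mB1 mB2 B')
  have "override_on N2 N' (participants l) = N2(p := B, q := B')"
    "override_on s2 s' (participants l) = s2"
    using S_Sel N s by (auto simp: override_on_def fun_eq_iff)
  then show ?thesis
    using S_Sel N s by (auto intro: sp_step.S_Sel)
next
  case (S_Then p b B1 B2)
  have "override_on N2 N' (participants l) = N2(p := B1)"
    "override_on s2 s' (participants l) = s2"
    using S_Then N s by (auto simp: override_on_def fun_eq_iff)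
  then show ?thesis
    using S_Then N s by (auto intro: sp_step.S_Then)
next
  case (S_Else p b B1 B2)
  have "override_on N2 N' (participants l) = N2(p := B2)"
    "override_on s2 s' (participants l) = s2"
    using S_Else N s by (auto simp: override_on_def fun_eq_iff)
  then show ?thesis
    using S_Else N s by (auto intro: sp_step.S_Else)
next
  case (S_Call p X B)
  have "override_on N2 N' (participants l) = N2(p := B)"
    "override_on s2 s' (participants l) = s2"
    using S_Call N s by (auto simp: override_on_def fun_eq_iff)
  then show ?thesis
    using S_Call N s by (auto intro: sp_step.S_Call)
qed

text \<open>The current behaviour of a process fixes the rule and the partner, the active partner
  fixes the value or label, and the two rules for conditionals exclude each other. So a process
  takes part in at most one enabled step.\<close>

lemma sp_step_shared_participant:
  assumes "sp_step c l a" "sp_step c l' b" "participants l \<inter> participants l' \<noteq> {}"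
  shows "a = b"
  using assms by (auto elim!: sp_step.cases)

lemma sp_reduces_diamond:
  assumes "sp_reduces c a" "sp_reduces c b" "a \<noteq> b"
  shows "\<exists>d. sp_reduces a d \<and> sp_reduces b d"
proof -
  obtain l l' where l: "sp_step c l a" and l': "sp_step c l' b"
    using assms by (auto simp: sp_reduces_def)
  obtain D N s where c: "c = ((D, N), s)" by (metis prod.collapse)
  obtain D1 N1 s1 where a: "a = ((D1, N1), s1)" by (metis prod.collapse)
  obtain D2 N2 s2 where b: "b = ((D2, N2), s2)" by (metis prod.collapse)
  have disj: "participants l \<inter> participants l' = {}"
    using sp_step_shared_participant[OF l l'] assms(3) by blast
  note st = l[unfolded c a] and st' = l'[unfolded c b]
  note loc = sp_step_local[OF st] and loc' = sp_step_local[OF st']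
  let ?N = "override_on N1 N2 (participants l')" and ?s = "override_on s1 s2 (participants l')"
  \<comment> \<open>The two overrides commute, as each changes only the participants of its own
    label.\<close>
  have N: "?N = override_on N2 N1 (participants l)"
    and s: "?s = override_on s2 s1 (participants l)"
    using disj loc loc' by (auto simp: override_on_def fun_eq_iff)
  have "sp_step a l' ((D, ?N), ?s)"
    using sp_step_transfer[OF st', of N1 s1] loc disj by (auto simp: a)
  moreover have "sp_step b l ((D, ?N), ?s)"
    using sp_step_transfer[OF st, of N2 s2] loc' disj unfolding N s by (auto simp: b)
  ultimately show ?thesis by (auto simp: sp_reduces_def)
qed

lemma terminated_no_step: "terminated c \<Longrightarrow> \<not> sp_reduces c d"
  by (auto simp: terminated_def sp_reduces_def elim!: sp_step.cases)

section \<open>Counting the steps to termination\<close>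

text \<open>The exact count serves as a measure twice: to exclude infinite executions when the
  result is defined, and to exclude halting ones when a loop diverges.\<close>

definition halts_in :: "nat \<Rightarrow> 'v config \<Rightarrow> 'v config \<Rightarrow> bool" where
  "halts_in n c t \<longleftrightarrow> (sp_reduces ^^ n) c t \<and> terminated t"

text \<open>Opaque on purpose: the simplifier's solver for transitive closures diverges on goals about
  updated networks.\<close>

definition steps :: "'v config \<Rightarrow> 'v config \<Rightarrow> bool" where
  "steps = sp_reduces\<^sup>*\<^sup>*"

lemma steps_trans [trans]: "steps a b \<Longrightarrow> steps b c \<Longrightarrow> steps a c"
  unfolding steps_def by (rule rtranclp_trans)

lemma steps_refl: "steps a a"
  unfolding steps_def by simp

lemma steps_single: "sp_reduces a b \<Longrightarrow> steps a b"
  unfolding steps_def by (rule r_into_rtranclp)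

text \<open>The diamond closes in exactly one step on either side, so each step, whichever it is, brings
  the configuration one step closer to termination.\<close>

lemma halts_in_step:
  assumes "halts_in n c t" "sp_reduces c d"
  shows "\<exists>m. n = Suc m \<and> halts_in m d t"
  using assms
proof (induction n arbitrary: c d)
  case 0
  then show ?case by (auto simp: halts_in_def dest: terminated_no_step)
next
  case (Suc n)
  then obtain e where e: "sp_reduces c e" "halts_in n e t"
    unfolding halts_in_def by (blast elim: relpowp_Suc_E2)
  show ?case
  proof (cases "d = e")
    case True
    then show ?thesis using e by auto
  next
    case False
    obtain f where f: "sp_reduces d f" "sp_reduces e f"
      using sp_reduces_diamond[OF Suc.prems(2) e(1) False] by blast
    obtain m where "n = Suc m" "halts_in m f t"
      using Suc.IH[OF e(2) f(2)] by blast
    then have "halts_in n d t"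
      using f(1) relpowp_Suc_I2[of sp_reduces d f m t] unfolding halts_in_def by blast
    then show ?thesis by blast
  qed
qed

lemma halts_in_steps:
  assumes "steps c d" "halts_in n c t"
  shows "\<exists>m\<le>n. halts_in m d t"
  using assms unfolding steps_def
proof (induction rule: rtranclp_induct)
  case base
  then show ?case by blast
next
  case (step d e)
  then obtain m where "m \<le> n" "halts_in m d t" by blast
  then show ?case using halts_in_step[OF _ step.hyps(2)] Suc_leD by blast
qed

lemma no_execution_terminates_iff:
  "no_execution_terminates c \<longleftrightarrow> (\<forall>n t. \<not> halts_in n c t)"
  by (auto simp: no_execution_terminates_def halts_in_def rtranclp_power)

text \<open>By confluence a halting run from \<open>c\<close> leaves one from \<open>d\<close>.
  Divergence may therefore be shown after following any convenient schedule.\<close>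

lemma no_execution_terminates_steps:
  assumes "steps c d" "no_execution_terminates d"
  shows "no_execution_terminates c"
  using assms halts_in_steps unfolding no_execution_terminates_iff by blast

lemma all_executions_terminate_inI:
  assumes "steps c t" "terminated t" "Q (snd t)"
  shows "all_executions_terminate_in c Q"
proof -
  obtain n where n: "halts_in n c t"
    using assms by (auto simp: halts_in_def steps_def rtranclp_power)
  have False if r: "r 0 = c" "\<And>i. sp_reduces (r i) (r (Suc i))" for r
  proof -
    have "\<exists>m. n = i + m \<and> halts_in m (r i) t" for i
    proof (induction i)
      case 0
      then show ?case using n r by auto
    next
      case (Suc i)
      then show ?case using halts_in_step[OF _ r(2)[of i]] by fastforce
    qed
    \<comment> \<open>The claim at index \<open>Suc n\<close>: an infinite run would make more steps
      than there are.\<close>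
    then obtain m where "n = Suc n + m" by blast
    then show False by simp
  qed
  moreover have "c' = t" if c': "sp_reduces\<^sup>*\<^sup>* c c'" "\<nexists>c''. sp_reduces c' c''" for c'
  proof -
    obtain m where m: "halts_in m c' t"
      using halts_in_steps[unfolded steps_def, OF c'(1) n] by blast
    \<comment> \<open>With a positive count there would be a next step, so the count is zero and
      \<open>c'\<close> is \<open>t\<close>; this excludes deadlocks.\<close>
    then show ?thesis
      using c'(2) unfolding halts_in_def by (cases m) (auto simp del: relpowp.simps(2) elim: relpowp_Suc_E2)
  qed
  ultimately show ?thesis
    using assms unfolding all_executions_terminate_in_def by blast
qed


section \<open>Register programs run by a controller process\<close>

type_synonym store = "pid \<Rightarrow> val"

section \<open>Until-loops on stores\<close>

context
  fixes i j :: pid and F :: "store \<Rightarrow> store option"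
begin

text \<open>As a least fixed point in the option order, \<open>None\<close> stands both for an
  endless loop and for a diverging body, and results of the form \<open>Some \<tau>\<close> come
  with fixpoint induction. The test is equality of two registers, the only test that the language
  offers.\<close>

partial_function (option) loop :: "store \<Rightarrow> store option" where
  "loop \<sigma> = (if \<sigma> i = \<sigma> j then Some \<sigma> else Option.bind (F \<sigma>) loop)"

end

lemma loop_exit: "\<sigma> i = \<sigma> j \<Longrightarrow> loop i j F \<sigma> = Some \<sigma>"
  by (simp add: loop.simps)

lemma loop_continue:
  "\<sigma> i \<noteq> \<sigma> j \<Longrightarrow> loop i j F \<sigma> = Option.bind (F \<sigma>) (loop i j F)"
  by (simp add: loop.simps)

text \<open>Partial correctness by fixpoint induction: a loop known to return needs no
  measure.\<close>

lemma loop_invariant: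
  assumes "loop i j F \<sigma> = Some \<tau>" "I \<sigma>"
    and "\<And>\<sigma> \<sigma>'. I \<sigma> \<Longrightarrow> \<sigma> i \<noteq> \<sigma> j \<Longrightarrow> F \<sigma> = Some \<sigma>' \<Longrightarrow> I \<sigma>'"
  shows "I \<tau> \<and> \<tau> i = \<tau> j"
proof -
  have "I \<sigma> \<longrightarrow> I \<tau> \<and> \<tau> i = \<tau> j"
  proof (rule loop.raw_induct[OF _ assms(1)])
    fix L \<sigma> \<tau>
    assume IH: "\<And>\<sigma> \<tau>. L \<sigma> = Some \<tau> \<Longrightarrow> I \<sigma> \<longrightarrow> I \<tau> \<and> \<tau> i = \<tau> j"
      and eq: "(if \<sigma> i = \<sigma> j then Some \<sigma> else Option.bind (F \<sigma>) L) = Some \<tau>"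
    show "I \<sigma> \<longrightarrow> I \<tau> \<and> \<tau> i = \<tau> j"
    proof (cases "\<sigma> i = \<sigma> j")
      case True
      then show ?thesis using eq by simp
    next
      case False
      then obtain \<rho> where "F \<sigma> = Some \<rho>" "L \<rho> = Some \<tau>"
        using eq by (auto simp: bind_eq_Some_conv)
      then show ?thesis using IH assms(3) False by blast
    qed
  qed
  then show ?thesis using assms(2) by simp
qed

section \<open>The protocol between the controller and the registers\<close>

locale controller =
  fixes C :: pid and x y :: 'v
  assumes xy: "x \<noteq> y"
begin

text \<open>Every process other than \<open>C\<close> is a register: \<open>C\<close> selects \<open>Left\<close> to read it,
  \<open>Right\<close> and \<open>Left\<close> to save it, and \<open>Right\<close> twice to shut it down. The procedure name
  \<open>0\<close> is reserved for this server.\<close>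

definition server :: "'v behaviour" where
  "server = Branch C (Some (Send C (Var x) (Call 0)))
     (Some (Branch C (Some (Recv C x (Call 0))) (Some End)))"

definition load :: "pid \<Rightarrow> 'v \<Rightarrow> 'v behaviour \<Rightarrow> 'v behaviour" where
  "load r v B = Select r Left (Recv r v B)"

definition save :: "pid \<Rightarrow> 'v expr \<Rightarrow> 'v behaviour \<Rightarrow> 'v behaviour" where
  "save r e B = Select r Right (Select r Left (Send r e B))"

definition stop :: "pid \<Rightarrow> 'v behaviour \<Rightarrow> 'v behaviour" where
  "stop r B = Select r Right (Select r Right B)"

lemma tau_call:
  assumes "fmlookup D X = Some B"
  shows "sp_reduces ((D, N(p := Call X)), s) ((D, N(p := B)), s)"
  using sp_step.S_Call[of "N(p := Call X)" p X D B s] assms by (auto simp: sp_reduces_def)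

lemma tau_server:
  assumes "fmlookup D 0 = Some server" "N r = Call 0"
  shows "steps ((D, N), s) ((D, N(r := server)), s)"
  using sp_step.S_Call[of N r 0 D server s] assms by (intro steps_single) (auto simp: sp_reduces_def)

lemma select_step:
  assumes "N p = Select q l B" "N q = Branch p mB1 mB2" "offer l mB1 mB2 = Some B'"
  shows "steps ((D, N), s) ((D, N(p := B, q := B')), s)"
  using sp_step.S_Sel[OF assms] by (intro steps_single) (auto simp: sp_reduces_def)

lemma com_step:
  assumes "N p = Send q e B" "N q = Recv p v B'"
  shows "steps ((D, N), s) ((D, N(p := B, q := B')), s(q := (s q)(v := eval_expr e (s p))))"
  using sp_step.S_Com[of N p q e B v B' "eval_expr e (s p)" s D] assms
  by (intro steps_single) (auto simp: sp_reduces_def)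

text \<open>The register unfolds its server, answers one request and is back at
  \<open>Call 0\<close>, so in the end only the controller's behaviour has changed.\<close>

lemma load_steps:
  assumes D: "fmlookup D 0 = Some server" and r: "N r = Call 0" "r \<noteq> C"
  shows "steps ((D, N(C := load r v B)), s)
    ((D, N(C := B)), s(C := (s C)(v := s r x)))"
proof -
  let ?N1 = "N(C := load r v B, r := server)"
  let ?N2 = "?N1(C := Recv r v B, r := Send C (Var x) (Call 0))"
  have "steps ((D, N(C := load r v B)), s) ((D, ?N1), s)"
    using tau_server[OF D, of "N(C := load r v B)" r] r by simp
  also have "steps ((D, ?N1), s) ((D, ?N2), s)"
    using r by (intro select_step) (auto simp: load_def server_def)
  also have "steps ((D, ?N2), s) ((D, N(C := B)), s(C := (s C)(v := s r x)))"
  proof -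
    have "?N2(r := Call 0, C := B) = N(C := B)"
      using r by (auto simp: fun_eq_iff)
    then show ?thesis
      using com_step[of ?N2 r C "Var x" "Call 0" v B D s] r by simp
  qed
  finally show ?thesis .
qed

lemma save_steps:
  assumes D: "fmlookup D 0 = Some server" and r: "N r = Call 0" "r \<noteq> C"
  shows "steps ((D, N(C := save r e B)), s)
    ((D, N(C := B)), s(r := (s r)(x := eval_expr e (s C))))"
proof -
  let ?N1 = "N(C := save r e B, r := server)"
  let ?N2 = "?N1(C := Select r Left (Send r e B),
    r := Branch C (Some (Recv C x (Call 0))) (Some End))"
  let ?N3 = "?N2(C := Send r e B, r := Recv C x (Call 0))"
  have "steps ((D, N(C := save r e B)), s) ((D, ?N1), s)"
    using tau_server[OF D, of "N(C := save r e B)" r] r by simp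
  also have "steps ((D, ?N1), s) ((D, ?N2), s)"
    using r by (intro select_step) (auto simp: save_def server_def)
  also have "steps ((D, ?N2), s) ((D, ?N3), s)"
    using r by (intro select_step) auto
  also have "steps ((D, ?N3), s) ((D, N(C := B)), s(r := (s r)(x := eval_expr e (s C))))"
  proof -
    have "?N3(C := B, r := Call 0) = N(C := B)"
      using r by (auto simp: fun_eq_iff)
    then show ?thesis
      using com_step[of ?N3 C r e B x "Call 0" D s] r by simp
  qed
  finally show ?thesis .
qed

lemma stop_steps:
  assumes D: "fmlookup D 0 = Some server" and r: "N r = Call 0" "r \<noteq> C"
  shows "steps ((D, N(C := stop r B)), s) ((D, N(r := End, C := B)), s)"
proof -
  let ?N1 = "N(C := stop r B, r := server)"
  let ?N2 = "?N1(C := Select r Right B, r := Branch C (Some (Recv C x (Call 0))) (Some End))"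
  have "steps ((D, N(C := stop r B)), s) ((D, ?N1), s)"
    using tau_server[OF D, of "N(C := stop r B)" r] r by simp
  also have "steps ((D, ?N1), s) ((D, ?N2), s)"
    using r by (intro select_step) (auto simp: stop_def server_def)
  also have "steps ((D, ?N2), s) ((D, N(r := End, C := B)), s)"
  proof -
    have "?N2(C := B, r := End) = N(r := End, C := B)"
      using r by (auto simp: fun_eq_iff)
    then show ?thesis
      using select_step[of ?N2 C r Right B "Some (Recv C x (Call 0))" "Some End" End D s] r
      by simp
  qed
  finally show ?thesis .
qed

text \<open>This runs the final continuation of every compiled program. The list must be distinct
  because a register already at \<open>End\<close> would leave a second \<open>stop\<close>
  stuck.\<close>

lemma stop_all_steps:
  assumes D: "fmlookup D 0 = Some server"
    and "\<And>r. r \<in> set rs \<Longrightarrow> N r = Call 0" "distinct rs" "C \<notin> set rs"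
  shows "steps ((D, N(C := foldr stop rs End)), s)
    ((D, \<lambda>p. if p \<in> set rs \<union> {C} then End else N p), s)"
  using assms(2-)
proof (induction rs arbitrary: N)
  case Nil
  show ?case by (simp add: fun_upd_def steps_refl)
next
  case (Cons r rs)
  have N: "(N(r := End)) r' = Call 0" if "r' \<in> set rs" for r'
    using that Cons.prems(1)[of r'] Cons.prems(2) by auto
  have a: "steps ((D, N(C := stop r (foldr stop rs End))), s)
      ((D, (N(r := End))(C := foldr stop rs End)), s)"
    using Cons.prems by (intro stop_steps D) auto
  have b: "steps ((D, (N(r := End))(C := foldr stop rs End)), s)
      ((D, \<lambda>p. if p \<in> set rs \<union> {C} then End else (N(r := End)) p), s)"
    using Cons.prems(2,3) by (intro Cons.IH[of "N(r := End)"] N) simp_all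
  have eq: "(\<lambda>p. if p \<in> set rs \<union> {C} then End else (N(r := End)) p) =
      (\<lambda>p. if p \<in> set (r # rs) \<union> {C} then End else N p)"
    by (auto simp: fun_eq_iff)
  show ?case
    unfolding eq[symmetric] foldr.simps o_apply by (rule steps_trans[OF a b])
qed

section \<open>Correctness of code fragments\<close>

text \<open>The controller's own store is left free: it is scratch space, and every fragment loads
  what it needs.\<close>

definition encodes :: "'v state \<Rightarrow> store \<Rightarrow> bool" where
  "encodes s \<sigma> \<longleftrightarrow> (\<forall>r. r \<noteq> C \<longrightarrow> s r x = \<sigma> r)"

text \<open>Quantifying over all definitions \<open>D\<close> that extend \<open>\<Delta>\<close>
  makes fragments linkable: a fragment stays correct inside a larger program. In the
  \<open>None\<close> case nothing may halt, whatever the continuation would do.\<close>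

definition correct_code ::
  "pid set \<Rightarrow> 'v proc_defs \<Rightarrow> (store \<Rightarrow> store option) \<Rightarrow> 'v behaviour \<Rightarrow> 'v behaviour \<Rightarrow> bool" where
  "correct_code R \<Delta> F B K \<longleftrightarrow>
     (\<forall>D N s \<sigma>. fmlookup \<Delta> \<subseteq>\<^sub>m fmlookup D \<and> fmlookup D 0 = Some server \<and>
         (\<forall>r\<in>R. N r = Call 0) \<and> encodes s \<sigma> \<longrightarrow>
       (case F \<sigma> of
          None \<Rightarrow> no_execution_terminates ((D, N(C := B)), s)
        | Some \<sigma>' \<Rightarrow> \<exists>s'. encodes s' \<sigma>' \<and>
            steps ((D, N(C := B)), s) ((D, N(C := K)), s')))"

lemma correct_codeI:
  assumes "\<And>D N s \<sigma>. fmlookup \<Delta> \<subseteq>\<^sub>m fmlookup D \<Longrightarrow> fmlookup D 0 = Some server \<Longrightarrow>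
      \<forall>r\<in>R. N r = Call 0 \<Longrightarrow> encodes s \<sigma> \<Longrightarrow> F \<sigma> = None \<Longrightarrow>
      no_execution_terminates ((D, N(C := B)), s)"
    and "\<And>D N s \<sigma> \<sigma>'. fmlookup \<Delta> \<subseteq>\<^sub>m fmlookup D \<Longrightarrow> fmlookup D 0 = Some server \<Longrightarrow>
      \<forall>r\<in>R. N r = Call 0 \<Longrightarrow> encodes s \<sigma> \<Longrightarrow> F \<sigma> = Some \<sigma>' \<Longrightarrow>
      \<exists>s'. encodes s' \<sigma>' \<and> steps ((D, N(C := B)), s) ((D, N(C := K)), s')"
  shows "correct_code R \<Delta> F B K"
  unfolding correct_code_def
proof (intro allI impI, elim conjE, goal_cases)
  case (1 D N s \<sigma>)
  then show ?case
    using assms[of D N s \<sigma>] by (cases "F \<sigma>") simp_all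
qed

lemma correct_codeD:
  assumes "correct_code R \<Delta> F B K" "fmlookup \<Delta> \<subseteq>\<^sub>m fmlookup D" "fmlookup D 0 = Some server"
    "\<forall>r\<in>R. N r = Call 0" "encodes s \<sigma>"
  shows "case F \<sigma> of
      None \<Rightarrow> no_execution_terminates ((D, N(C := B)), s)
    | Some \<sigma>' \<Rightarrow> \<exists>s'. encodes s' \<sigma>' \<and>
        steps ((D, N(C := B)), s) ((D, N(C := K)), s')"
  using assms unfolding correct_code_def by blast

lemma correct_code_None:
  assumes "correct_code R \<Delta> F B K" "fmlookup \<Delta> \<subseteq>\<^sub>m fmlookup D" "fmlookup D 0 = Some server"
    "\<forall>r\<in>R. N r = Call 0" "encodes s \<sigma>" "F \<sigma> = None"
  shows "no_execution_terminates ((D, N(C := B)), s)"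
  using correct_codeD[OF assms(1-5)] assms(6) by simp

lemma correct_code_Some:
  assumes "correct_code R \<Delta> F B K" "fmlookup \<Delta> \<subseteq>\<^sub>m fmlookup D" "fmlookup D 0 = Some server"
    "\<forall>r\<in>R. N r = Call 0" "encodes s \<sigma>" "F \<sigma> = Some \<sigma>'"
  shows "\<exists>s'. encodes s' \<sigma>' \<and> steps ((D, N(C := B)), s) ((D, N(C := K)), s')"
  using correct_codeD[OF assms(1-5)] assms(6) by simp

text \<open>The registers \<open>R\<close> are fixed before the continuation \<open>K\<close>, since the final continuation
  has to shut them down; \<open>U\<close> is the set of procedure names that are already taken.\<close>

definition computable :: "(store \<Rightarrow> store option) \<Rightarrow> bool" where
  "computable F \<longleftrightarrow> (\<exists>R. finite R \<and> C \<notin> R \<and>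
     (\<forall>K U. finite U \<longrightarrow> (\<exists>B \<Delta>. fmdom' \<Delta> \<inter> U = {} \<and> correct_code R \<Delta> F B K)))"

lemma computableI:
  assumes "finite R" "C \<notin> R"
    and "\<And>K U. finite U \<Longrightarrow> \<exists>B \<Delta>. fmdom' \<Delta> \<inter> U = {} \<and> correct_code R \<Delta> F B K"
  shows "computable F"
  unfolding computable_def using assms by (intro exI[of _ R] conjI allI impI)

section \<open>Compiling assignments, sequences and loops\<close>

text \<open>Register \<open>j\<close> is loaded into the controller's \<open>x\<close>, where
  \<open>e\<close> is evaluated. As \<open>x\<close> is the only variable of \<open>e\<close>, this
  equals evaluation in the constant store \<open>\<lambda>_. \<sigma> j\<close>, which covers all
  three forms of expression at once.\<close>

lemma computable_assign:
  assumes "i \<noteq> C" "j \<noteq> C" "set_expr e \<subseteq> {x}"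
  shows "computable (\<lambda>\<sigma>. Some (\<sigma>(i := eval_expr e (\<lambda>_. \<sigma> j))))"
proof -
  have "correct_code {i, j} fmempty (\<lambda>\<sigma>. Some (\<sigma>(i := eval_expr e (\<lambda>_. \<sigma> j))))
      (load j x (save i e K)) K" for K
  proof (rule correct_codeI, goal_cases)
    case (2 D N s \<sigma> \<sigma>')
    let ?s = "s(C := (s C)(x := s j x))"
    have s: "eval_expr e (?s C) = eval_expr e (\<lambda>_. \<sigma> j)"
      using assms 2(4) by (cases e) (simp_all add: encodes_def)
    let ?s' = "?s(i := (?s i)(x := eval_expr e (?s C)))"
    have "steps ((D, N(C := load j x (save i e K))), s) ((D, N(C := save i e K)), ?s)"
      using 2(2,3) assms(2) by (simp add: load_steps)
    moreover have "steps ((D, N(C := save i e K)), ?s) ((D, N(C := K)), ?s')"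
      using 2(2,3) assms(1) by (intro save_steps) simp_all
    ultimately have "steps ((D, N(C := load j x (save i e K))), s) ((D, N(C := K)), ?s')"
      by (rule steps_trans)
    moreover have "encodes ?s' \<sigma>'"
      using 2(4,5) assms unfolding s by (auto simp: encodes_def)
    ultimately show ?case by blast
  qed simp
  then have "\<exists>B \<Delta>. fmdom' \<Delta> \<inter> U = {} \<and>
      correct_code {i, j} \<Delta> (\<lambda>\<sigma>. Some (\<sigma>(i := eval_expr e (\<lambda>_. \<sigma> j)))) B K" for K U
    by (intro exI[of _ "load j x (save i e K)"] exI[of _ fmempty]) simp
  then show ?thesis using assms by (intro computableI[of "{i, j}"]) auto
qed

lemma correct_code_mono:
  assumes "correct_code R \<Delta> F B K" "R \<subseteq> R'" "fmlookup \<Delta> \<subseteq>\<^sub>m fmlookup \<Delta>'"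
  shows "correct_code R' \<Delta>' F B K"
  using assms map_le_trans unfolding correct_code_def by blast

text \<open>The code is built backwards: that of \<open>G\<close> comes first, since it is the
  continuation with which \<open>F\<close> is compiled.\<close>

lemma computable_seq:
  assumes "computable F" "computable G"
  shows "computable (\<lambda>\<sigma>. Option.bind (F \<sigma>) G)"
proof -
  obtain R where R: "finite R" "C \<notin> R"
    "\<And>K U. finite U \<Longrightarrow> \<exists>B \<Delta>. fmdom' \<Delta> \<inter> U = {} \<and> correct_code R \<Delta> F B K"
    using assms(1) unfolding computable_def by blast
  obtain S where S: "finite S" "C \<notin> S"
    "\<And>K U. finite U \<Longrightarrow> \<exists>B \<Delta>. fmdom' \<Delta> \<inter> U = {} \<and> correct_code S \<Delta> G B K"
    using assms(2) unfolding computable_def by blast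
  have "\<exists>B \<Delta>. fmdom' \<Delta> \<inter> U = {} \<and> correct_code (R \<union> S) \<Delta> (\<lambda>\<sigma>. Option.bind (F \<sigma>) G) B K"
    if "finite U" for K U
  proof -
    obtain B2 \<Delta>2 where 2: "fmdom' \<Delta>2 \<inter> U = {}" "correct_code S \<Delta>2 G B2 K"
      using S(3)[OF \<open>finite U\<close>] by blast
    have "finite (U \<union> fmdom' \<Delta>2)" using \<open>finite U\<close> by simp
    then obtain B1 \<Delta>1 where 1: "fmdom' \<Delta>1 \<inter> (U \<union> fmdom' \<Delta>2) = {}" "correct_code R \<Delta>1 F B1 B2"
      using R(3) by blast
    let ?\<Delta> = "\<Delta>1 ++\<^sub>f \<Delta>2"
    \<comment> \<open>The right operand of the union takes precedence, so it is here that the names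
      of the two fragments must be disjoint.\<close>
    have le1: "fmlookup \<Delta>1 \<subseteq>\<^sub>m fmlookup ?\<Delta>"
      using 1(1) by (auto simp: map_le_def fmlookup_dom'_iff fmdom'_notI disjoint_iff)
    have le2: "fmlookup \<Delta>2 \<subseteq>\<^sub>m fmlookup ?\<Delta>"
      by (auto simp: map_le_def fmlookup_dom'_iff)
    have c1: "correct_code (R \<union> S) ?\<Delta> F B1 B2" and c2: "correct_code (R \<union> S) ?\<Delta> G B2 K"
      using correct_code_mono[OF 1(2) _ le1] correct_code_mono[OF 2(2) _ le2] by auto
    have "correct_code (R \<union> S) ?\<Delta> (\<lambda>\<sigma>. Option.bind (F \<sigma>) G) B1 K"
    proof (rule correct_codeI, goal_cases)
      case (1 D N s \<sigma>)
      show ?case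
      proof (cases "F \<sigma>")
        case None
        show ?thesis by (rule correct_code_None[OF c1 1(1-4) None])
      next
        case (Some \<sigma>1)
        then obtain s1 where s1: "encodes s1 \<sigma>1"
          "steps ((D, N(C := B1)), s) ((D, N(C := B2)), s1)"
          using correct_code_Some[OF c1 1(1-4)] by blast
        have "G \<sigma>1 = None" using 1(5) Some by simp
        from correct_code_None[OF c2 1(1-3) s1(1) this] show ?thesis
          using no_execution_terminates_steps[OF s1(2)] by blast
      qed
    next
      case (2 D N s \<sigma> \<sigma>')
      then obtain \<sigma>1 where \<sigma>1: "F \<sigma> = Some \<sigma>1" "G \<sigma>1 = Some \<sigma>'"
        by (auto simp: bind_eq_Some_conv)
      obtain s1 where s1: "encodes s1 \<sigma>1"
        "steps ((D, N(C := B1)), s) ((D, N(C := B2)), s1)"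
        using correct_code_Some[OF c1 2(1-4) \<sigma>1(1)] by blast
      then show ?case
        using correct_code_Some[OF c2 2(1-3) s1(1) \<sigma>1(2)] by (meson steps_trans)
    qed
    moreover have "fmdom' ?\<Delta> \<inter> U = {}" using 1 2 by auto
    ultimately show ?thesis by blast
  qed
  then show ?thesis using R(1,2) S(1,2) by (intro computableI[of "R \<union> S"]) simp_all
qed

text \<open>The two registers are brought into different variables of the controller;
  \<open>x \<noteq> y\<close> keeps the second load from overwriting the first.\<close>

lemma test_steps:
  assumes D: "fmlookup D 0 = Some server" and ij: "N i = Call 0" "N j = Call 0" "i \<noteq> C" "j \<noteq> C"
    and s: "encodes s \<sigma>"
  shows "\<exists>s'. encodes s' \<sigma> \<and> steps
    ((D, N(C := load i x (load j y (Cond (Eq x y) K B)))), s)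
    ((D, N(C := if \<sigma> i = \<sigma> j then K else B)), s')"
proof -
  let ?s1 = "s(C := (s C)(x := s i x))"
  let ?s2 = "?s1(C := (?s1 C)(y := ?s1 j x))"
  let ?N = "N(C := Cond (Eq x y) K B)"
  have "steps ((D, N(C := load i x (load j y (Cond (Eq x y) K B)))), s)
      ((D, N(C := load j y (Cond (Eq x y) K B))), ?s1)"
    using assms by (intro load_steps) simp_all
  moreover have "steps ((D, N(C := load j y (Cond (Eq x y) K B))), ?s1) ((D, ?N), ?s2)"
    using assms by (intro load_steps) simp_all
  moreover have "sp_reduces ((D, ?N), ?s2) ((D, N(C := if \<sigma> i = \<sigma> j then K else B)), ?s2)"
  proof (cases "\<sigma> i = \<sigma> j")
    case True
    then have "eval_bexpr (Eq x y) (?s2 C)"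
      using xy s ij by (auto simp: encodes_def)
    then show ?thesis
      using sp_step.S_Then[of ?N C "Eq x y" K B ?s2 D] True by (auto simp: sp_reduces_def)
  next
    case False
    then have "\<not> eval_bexpr (Eq x y) (?s2 C)"
      using xy s ij by (auto simp: encodes_def)
    then show ?thesis
      using sp_step.S_Else[of ?N C "Eq x y" K B ?s2 D] False by (auto simp: sp_reduces_def)
  qed
  ultimately have "steps ((D, N(C := load i x (load j y (Cond (Eq x y) K B)))), s)
      ((D, N(C := if \<sigma> i = \<sigma> j then K else B)), ?s2)"
    using steps_single steps_trans by meson
  moreover have "encodes ?s2 \<sigma>" using s by (auto simp: encodes_def)
  ultimately show ?thesis by blast
qed

text \<open>The body is compiled with continuation \<open>Call X\<close>, so \<open>X\<close> is
  chosen before the body and the names used by the body must avoid it.\<close>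

lemma computable_loop:
  assumes F: "computable F" and ij: "i \<noteq> C" "j \<noteq> C"
  shows "computable (loop i j F)"
proof -
  obtain R where R: "finite R" "C \<notin> R"
    "\<And>K U. finite U \<Longrightarrow> \<exists>B \<Delta>. fmdom' \<Delta> \<inter> U = {} \<and> correct_code R \<Delta> F B K"
    using F unfolding computable_def by blast
  let ?R = "R \<union> {i, j}"
  have "\<exists>B \<Delta>. fmdom' \<Delta> \<inter> U = {} \<and> correct_code ?R \<Delta> (loop i j F) B K"
    if "finite U" for K U
  proof -
    obtain X where X: "X \<notin> U" using \<open>finite U\<close> ex_new_if_finite infinite_UNIV_nat by blast
    obtain B \<Delta>' where B: "fmdom' \<Delta>' \<inter> insert X U = {}" "correct_code R \<Delta>' F B (Call X)"
      using R(3)[of "insert X U" "Call X"] \<open>finite U\<close> by auto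
    define W where "W = load i x (load j y (Cond (Eq x y) K B))"
    define \<Delta> where "\<Delta> = fmupd X W \<Delta>'"
    have le: "fmlookup \<Delta>' \<subseteq>\<^sub>m fmlookup \<Delta>"
      using B(1) by (auto simp: \<Delta>_def map_le_def fmlookup_dom'_iff)
    have c: "correct_code ?R \<Delta> F B (Call X)"
      using correct_code_mono[OF B(2) _ le] by blast
    \<comment> \<open>The unfolding of \<open>X\<close> is kept apart as one genuine step: it makes
      every iteration shorten a halting run, even where the code of \<open>F\<close> makes no
      step.\<close>
    have enter: "\<exists>s' c. encodes s' \<sigma> \<and> sp_reduces ((D, N(C := Call X)), s) c \<and>
        steps c ((D, N(C := if \<sigma> i = \<sigma> j then K else B)), s')"
      if "fmlookup \<Delta> \<subseteq>\<^sub>m fmlookup D" "fmlookup D 0 = Some server"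
        "\<forall>r\<in>?R. N r = Call 0" "encodes s \<sigma>" for D N s \<sigma>
    proof -
      have "fmlookup D X = Some W"
        using that(1) by (auto simp: \<Delta>_def map_le_def dom_def split: if_splits)
      then have "sp_reduces ((D, N(C := Call X)), s) ((D, N(C := W)), s)" by (rule tau_call)
      moreover have "\<exists>s'. encodes s' \<sigma> \<and> steps ((D, N(C := W)), s)
          ((D, N(C := if \<sigma> i = \<sigma> j then K else B)), s')"
        unfolding W_def using that ij by (intro test_steps) auto
      ultimately show ?thesis by blast
    qed
    have "correct_code ?R \<Delta> (loop i j F) (Call X) K"
    proof (rule correct_codeI, goal_cases)
      case (1 D N s \<sigma>)
      \<comment> \<open>Strong induction on the length of a supposed halting run: either the body
        diverges, or the run passes through \<open>Call X\<close> again with fewer steps left, in a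
        store on which the loop is still undefined.\<close>
      have "\<not> halts_in n ((D, N(C := Call X)), s) t" for n t
        using 1(4,5)
      proof (induction n arbitrary: s \<sigma> rule: less_induct)
        case (less n)
        have ne: "\<sigma> i \<noteq> \<sigma> j" using less.prems(2) loop_exit[of \<sigma> i j F] by auto
        obtain s' c' where s': "encodes s' \<sigma>" "sp_reduces ((D, N(C := Call X)), s) c'"
          "steps c' ((D, N(C := B)), s')"
          using enter[OF 1(1-3) less.prems(1)] ne by auto
        show ?case
        proof
          assume "halts_in n ((D, N(C := Call X)), s) t"
          then obtain m m' where m: "n = Suc m'" "m \<le> m'" "halts_in m ((D, N(C := B)), s') t"
            using halts_in_step[OF _ s'(2)] halts_in_steps[OF s'(3)] by blast
          show False
          proof (cases "F \<sigma>")
            case None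
            then show False
              using correct_code_None[OF c 1(1-3) s'(1)] m(3) no_execution_terminates_iff by blast
          next
            case (Some \<sigma>1)
            then obtain s1 where s1: "encodes s1 \<sigma>1"
              "steps ((D, N(C := B)), s') ((D, N(C := Call X)), s1)"
              using correct_code_Some[OF c 1(1-3) s'(1)] by blast
            have "loop i j F \<sigma>1 = None"
              using less.prems(2) loop_continue[of \<sigma> i j F, OF ne] Some by simp
            then show False
              using halts_in_steps[OF s1(2) m(3)] m less.IH s1(1)
              by (meson le_imp_less_Suc le_trans)
          qed
        qed
      qed
      then show ?case using no_execution_terminates_iff by blast
    next
      case (2 D N s \<sigma> \<sigma>')
      \<comment> \<open>The state is generalised, because each iteration returns to
        \<open>Call X\<close> with a different state.\<close>
      have "\<forall>s. encodes s \<sigma> \<longrightarrow> (\<exists>s'. encodes s' \<sigma>' \<and>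
          steps ((D, N(C := Call X)), s) ((D, N(C := K)), s'))"
      proof (rule loop.raw_induct[OF _ 2(5)], intro allI impI)
        fix L \<sigma> \<tau> s
        assume IH: "\<And>\<sigma> \<tau>. L \<sigma> = Some \<tau> \<Longrightarrow> \<forall>s. encodes s \<sigma> \<longrightarrow> (\<exists>s'. encodes s' \<tau> \<and>
            steps ((D, N(C := Call X)), s) ((D, N(C := K)), s'))"
          and eq: "(if \<sigma> i = \<sigma> j then Some \<sigma> else Option.bind (F \<sigma>) L) = Some \<tau>"
          and s: "encodes s \<sigma>"
        obtain s1 where s1: "encodes s1 \<sigma>" "steps ((D, N(C := Call X)), s)
            ((D, N(C := if \<sigma> i = \<sigma> j then K else B)), s1)"
          using enter[OF 2(1-3) s] by (meson steps_single steps_trans)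
        show "\<exists>s'. encodes s' \<tau> \<and>
            steps ((D, N(C := Call X)), s) ((D, N(C := K)), s')"
        proof (cases "\<sigma> i = \<sigma> j")
          case True
          then show ?thesis using s1 eq by auto
        next
          case False
          then obtain \<rho> where \<rho>: "F \<sigma> = Some \<rho>" "L \<rho> = Some \<tau>"
            using eq by (auto simp: bind_eq_Some_conv)
          obtain s2 where s2: "encodes s2 \<rho>"
            "steps ((D, N(C := B)), s1) ((D, N(C := Call X)), s2)"
            using correct_code_Some[OF c 2(1-3) s1(1) \<rho>(1)] by blast
          obtain s3 where "encodes s3 \<tau>"
            "steps ((D, N(C := Call X)), s2) ((D, N(C := K)), s3)"
            using IH[OF \<rho>(2)] s2(1) by blast
          moreover have "steps ((D, N(C := Call X)), s) ((D, N(C := B)), s1)"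
            using s1(2) False by simp
          ultimately show ?thesis using s2(2) by (meson steps_trans)
        qed
      qed
      then show ?case using 2(4) by blast
    qed
    moreover have "fmdom' \<Delta> \<inter> U = {}" using B(1) X by (auto simp: \<Delta>_def)
    ultimately show ?thesis by blast
  qed
  then show ?thesis using R(1,2) ij by (intro computableI[of ?R]) simp_all
qed

section \<open>Complete programs\<close>

lemma computable_program:
  assumes "computable F"
  shows "\<exists>P. network_wf (snd P) \<and> (\<forall>s. case F (\<lambda>r. s r x) of
      None \<Rightarrow> no_execution_terminates (P, s)
    | Some \<sigma>' \<Rightarrow> all_executions_terminate_in (P, s) (\<lambda>s'. \<forall>r. r \<noteq> C \<longrightarrow> s' r x = \<sigma>' r))"
proof -
  obtain R where R: "finite R" "C \<notin> R"
    "\<And>K U. finite U \<Longrightarrow> \<exists>B \<Delta>. fmdom' \<Delta> \<inter> U = {} \<and> correct_code R \<Delta> F B K"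
    using assms unfolding computable_def by blast
  obtain rs where rs: "set rs = R" "distinct rs"
    using finite_distinct_list[OF R(1)] by blast
  \<comment> \<open>\<open>R\<close> is known before the code is compiled, so its shutdown can serve
    as the continuation. The names \<open>0\<close> and \<open>1\<close> are kept free for the
    server and the entry point.\<close>
  let ?K = "foldr stop rs End"
  obtain B \<Delta> where B: "fmdom' \<Delta> \<inter> {0, 1} = {}" "correct_code R \<Delta> F B ?K"
    using R(3)[of "{0, 1}" ?K] by auto
  define D where "D = fmupd 1 B (fmupd 0 server \<Delta>)"
  define N :: "'v network" where "N = (\<lambda>p. if p \<in> R then Call 0 else End)"
  have D: "fmlookup \<Delta> \<subseteq>\<^sub>m fmlookup D" "fmlookup D 0 = Some server" "fmlookup D 1 = Some B"
    using B(1) by (auto simp: D_def map_le_def fmlookup_dom'_iff intro!: gr0I)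
  have N: "\<forall>r\<in>R. N r = Call 0" by (simp add: N_def)
  \<comment> \<open>The controller's code is a procedure body, which \<open>network_wf\<close> does not inspect.\<close>
  let ?P = "(D, N(C := Call 1))"
  have start: "steps (?P, s) ((D, N(C := B)), s)" for s
    using tau_call[OF D(3)] by (rule steps_single)
  have "case F (\<lambda>r. s r x) of
      None \<Rightarrow> no_execution_terminates (?P, s)
    | Some \<sigma>' \<Rightarrow> all_executions_terminate_in (?P, s) (\<lambda>s'. \<forall>r. r \<noteq> C \<longrightarrow> s' r x = \<sigma>' r)" for s
  proof -
    have s: "encodes s (\<lambda>r. s r x)" by (simp add: encodes_def)
    show ?thesis
    proof (cases "F (\<lambda>r. s r x)")
      case None
      then show ?thesis
        using correct_code_None[OF B(2) D(1,2) N s None]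
          no_execution_terminates_steps[OF start] by simp
    next
      case (Some \<sigma>')
      then obtain s' where s': "encodes s' \<sigma>'"
        "steps ((D, N(C := B)), s) ((D, N(C := ?K)), s')"
        using correct_code_Some[OF B(2) D(1,2) N s Some] by blast
      let ?t = "((D, \<lambda>p. if p \<in> set rs \<union> {C} then End else N p), s')"
      have "steps ((D, N(C := ?K)), s') ?t"
        using rs R(2) N by (intro stop_all_steps D(2)) auto
      then have "steps (?P, s) ?t"
        using start s'(2) by (meson steps_trans)
      moreover have "terminated ?t" using rs by (auto simp: terminated_def N_def)
      ultimately have "all_executions_terminate_in (?P, s) (\<lambda>s'. \<forall>r. r \<noteq> C \<longrightarrow> s' r x = \<sigma>' r)"
        using s'(1) by (intro all_executions_terminate_inI) (auto simp: encodes_def)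
      then show ?thesis using Some by simp
    qed
  qed
  moreover have "network_wf (snd ?P)"
    by (auto simp: network_wf_def N_def)
  ultimately show ?thesis by blast
qed


section \<open>Partial recursive functions as register programs\<close>

lemma computable_zero: "i \<noteq> C \<Longrightarrow> computable (\<lambda>\<sigma>. Some (\<sigma>(i := 0)))"
  using computable_assign[of i i Zero] by simp

lemma computable_copy: "i \<noteq> C \<Longrightarrow> j \<noteq> C \<Longrightarrow> computable (\<lambda>\<sigma>. Some (\<sigma>(i := \<sigma> j)))"
  using computable_assign[of i j "Var x"] by simp

lemma computable_suc: "i \<noteq> C \<Longrightarrow> j \<noteq> C \<Longrightarrow> computable (\<lambda>\<sigma>. Some (\<sigma>(i := Suc (\<sigma> j))))"
  using computable_assign[of i j "SucVar x"] by simp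

text \<open>\<open>F\<close>, started in \<open>\<sigma>\<close>, computes \<open>v\<close> into the register \<open>out\<close>, using only the
  registers from \<open>k\<close> on as scratch space.\<close>

definition yields :: "nat \<Rightarrow> pid \<Rightarrow> (store \<Rightarrow> store option) \<Rightarrow> store \<Rightarrow> val option \<Rightarrow> bool" where
  "yields k out F \<sigma> v \<longleftrightarrow> (case v of
      None \<Rightarrow> F \<sigma> = None
    | Some m \<Rightarrow> \<exists>\<sigma>'. F \<sigma> = Some \<sigma>' \<and> \<sigma>' out = m \<and> (\<forall>r<k. r \<noteq> out \<longrightarrow> \<sigma>' r = \<sigma> r))"

lemma yields_None: "yields k out F \<sigma> None \<longleftrightarrow> F \<sigma> = None"
  by (simp add: yields_def)

lemma yields_Some: "yields k out F \<sigma> (Some m) \<longleftrightarrow>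
    (\<exists>\<sigma>'. F \<sigma> = Some \<sigma>' \<and> \<sigma>' out = m \<and> (\<forall>r<k. r \<noteq> out \<longrightarrow> \<sigma>' r = \<sigma> r))"
  by (simp add: yields_def)

text \<open>Scratch registers are those from \<open>k\<close> on, so \<open>C < k\<close> keeps the
  controller out of them. With \<open>out\<close> outside the arguments, \<open>out\<close> can hold
  intermediate results while the arguments are still being read.\<close>

definition register_layout :: "nat \<Rightarrow> pid \<Rightarrow> pid list \<Rightarrow> bool" where
  "register_layout k out is \<longleftrightarrow>
     C < k \<and> out < k \<and> out \<noteq> C \<and> set is \<subseteq> {..<k} \<and> C \<notin> set is \<and> out \<notin> set is"

text \<open>All layouts are allowed, so that a function used inside another one can read from and
  write to registers of the caller's choice.\<close>

definition implementable :: "nat \<Rightarrow> pfun \<Rightarrow> bool" where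
  "implementable n f \<longleftrightarrow> (\<forall>k out is. register_layout k out is \<and> length is = n \<longrightarrow>
     (\<exists>F. computable F \<and> (\<forall>\<sigma>. yields k out F \<sigma> (f (map \<sigma> is)))))"

lemma implementableD:
  assumes "implementable n f" "register_layout k out is" "length is = n"
  shows "\<exists>F. computable F \<and> (\<forall>\<sigma>. yields k out F \<sigma> (f (map \<sigma> is)))"
  using assms unfolding implementable_def by blast

lemma implementable_zero: "implementable n (\<lambda>xs. Some 0)"
  unfolding implementable_def register_layout_def
  by (auto simp: yields_Some intro!: exI computable_zero)

lemma implementable_succ: "implementable 1 (\<lambda>xs. Some (Suc (hd xs)))"
  unfolding implementable_def
proof (intro allI impI, elim conjE)
  fix k out :: nat and "is" :: "nat list"
  assume l: "register_layout k out is" "length is = 1"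
  then obtain i where i: "is = [i]" by (auto simp: length_Suc_conv)
  then have "computable (\<lambda>\<sigma>. Some (\<sigma>(out := Suc (\<sigma> i))))"
    using l by (intro computable_suc) (auto simp: register_layout_def)
  then show "\<exists>F. computable F \<and> (\<forall>\<sigma>. yields k out F \<sigma> (Some (Suc (hd (map \<sigma> is)))))"
    by (intro exI conjI) (auto simp: i yields_Some)
qed

lemma implementable_proj:
  assumes "i < n"
  shows "implementable n (\<lambda>xs. Some (xs ! i))"
  unfolding implementable_def
proof (intro allI impI, elim conjE)
  fix k out :: nat and "is" :: "nat list"
  assume l: "register_layout k out is" "length is = n"
  then have "is ! i \<in> set is" using assms by simp
  then have "computable (\<lambda>\<sigma>. Some (\<sigma>(out := \<sigma> (is ! i))))"
    using l by (intro computable_copy) (auto simp: register_layout_def)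
  then show "\<exists>F. computable F \<and> (\<forall>\<sigma>. yields k out F \<sigma> (Some (map \<sigma> is ! i)))"
    using l assms by (intro exI conjI) (auto simp: yields_Some)
qed

lemma implementable_cong:
  assumes "implementable n f" "\<forall>xs. length xs = n \<longrightarrow> f' xs = f xs"
  shows "implementable n f'"
  using assms unfolding implementable_def by simp

section \<open>Composition\<close>

text \<open>Each value goes to the lowest scratch register and the scratch bound then rises by one.
  Thus the inputs and the values found so far survive the computation of the next one.\<close>

lemma computable_arguments:
  assumes "\<forall>h\<in>set hs. implementable n h" "length is = n"
    and "C < k" "set is \<subseteq> {..<k}" "C \<notin> set is"
  shows "\<exists>F. computable F \<and> (\<forall>\<sigma>. case those (map (\<lambda>h. h (map \<sigma> is)) hs) of
      None \<Rightarrow> F \<sigma> = None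
    | Some vs \<Rightarrow> \<exists>\<sigma>'. F \<sigma> = Some \<sigma>' \<and> map \<sigma>' [k..<k + length hs] = vs \<and> (\<forall>r<k. \<sigma>' r = \<sigma> r))"
  using assms(1,3,4)
proof (induction hs arbitrary: k)
  case Nil
  \<comment> \<open>Copying register \<open>k\<close> to itself is the identity.\<close>
  then have "computable Some" using computable_copy[of k k] by simp
  then show ?case by auto
next
  case (Cons h hs)
  have "register_layout (Suc k) k is"
    using Cons.prems(2,3) assms(5) by (auto simp: register_layout_def)
  then obtain F1 where F1: "computable F1" "\<And>\<sigma>. yields (Suc k) k F1 \<sigma> (h (map \<sigma> is))"
    using implementableD[of n h "Suc k" k "is"] Cons.prems(1) assms(2) by (meson list.set_intros(1))
  have "set is \<subseteq> {..<Suc k}" using Cons.prems(3) by auto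
  then obtain F2 where F2: "computable F2"
    "\<And>\<sigma>. case those (map (\<lambda>h. h (map \<sigma> is)) hs) of
        None \<Rightarrow> F2 \<sigma> = None
      | Some vs \<Rightarrow> \<exists>\<sigma>'. F2 \<sigma> = Some \<sigma>' \<and> map \<sigma>' [Suc k..<Suc k + length hs] = vs \<and>
          (\<forall>r<Suc k. \<sigma>' r = \<sigma> r)"
    using Cons.IH[of "Suc k"] Cons.prems(1,2) by auto
  let ?F = "\<lambda>\<sigma>. Option.bind (F1 \<sigma>) F2"
  have "case those (map (\<lambda>h. h (map \<sigma> is)) (h # hs)) of
        None \<Rightarrow> ?F \<sigma> = None
      | Some vs \<Rightarrow> \<exists>\<sigma>'. ?F \<sigma> = Some \<sigma>' \<and> map \<sigma>' [k..<k + length (h # hs)] = vs \<and>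
          (\<forall>r<k. \<sigma>' r = \<sigma> r)" for \<sigma>
  proof (cases "h (map \<sigma> is)")
    case None
    then show ?thesis using F1(2)[of \<sigma>] by (simp add: yields_None)
  next
    case (Some m)
    then obtain \<sigma>1 where \<sigma>1: "F1 \<sigma> = Some \<sigma>1" "\<sigma>1 k = m" "\<forall>r<k. \<sigma>1 r = \<sigma> r"
      using F1(2)[of \<sigma>] by (auto simp: yields_Some)
    have args: "map \<sigma>1 is = map \<sigma> is" using \<sigma>1(3) Cons.prems(3) by auto
    have upt: "[k..<k + length (h # hs)] = k # [Suc k..<Suc k + length hs]"
      using upt_conv_Cons[of k "k + length (h # hs)"] by (simp del: upt_Suc)
    show ?thesis
      using F2(2)[of \<sigma>1] \<sigma>1 Some unfolding args upt
      by (cases "those (map (\<lambda>h. h (map \<sigma> is)) hs)") auto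
  qed
  then show ?case using computable_seq[OF F1(1) F2(1)] by blast
qed

text \<open>All arguments are evaluated before \<open>g\<close> starts, even those that
  \<open>g\<close> ignores, which matches the strictness of \<open>pf_comp\<close>.\<close>

lemma implementable_comp:
  assumes g: "implementable (length hs) g" and hs: "\<forall>h\<in>set hs. implementable n h"
  shows "implementable n (pf_comp g hs)"
  unfolding implementable_def
proof (intro allI impI, elim conjE)
  fix k out :: nat and "is" :: "nat list"
  assume l: "register_layout k out is" "length is = n"
  obtain F where F: "computable F"
    "\<And>\<sigma>. case those (map (\<lambda>h. h (map \<sigma> is)) hs) of
        None \<Rightarrow> F \<sigma> = None
      | Some vs \<Rightarrow> \<exists>\<sigma>'. F \<sigma> = Some \<sigma>' \<and> map \<sigma>' [k..<k + length hs] = vs \<and> (\<forall>r<k. \<sigma>' r = \<sigma> r)"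
    using computable_arguments[OF hs l(2), of k] l(1) by (auto simp: register_layout_def)
  have "register_layout (k + length hs) out [k..<k + length hs]"
    using l(1) by (auto simp: register_layout_def)
  then obtain G where G: "computable G"
    "\<And>\<sigma>. yields (k + length hs) out G \<sigma> (g (map \<sigma> [k..<k + length hs]))"
    using implementableD[OF g, of "k + length hs" out "[k..<k + length hs]"]
    by (metis add_diff_cancel_left' length_upt)
  have "yields k out (\<lambda>\<sigma>. Option.bind (F \<sigma>) G) \<sigma> (pf_comp g hs (map \<sigma> is))" for \<sigma>
  proof (cases "those (map (\<lambda>h. h (map \<sigma> is)) hs)")
    case None
    then show ?thesis using F(2)[of \<sigma>] by (simp add: pf_comp_def yields_None)
  next
    case (Some vs)
    then obtain \<sigma>1 where \<sigma>1: "F \<sigma> = Some \<sigma>1" "map \<sigma>1 [k..<k + length hs] = vs" "\<forall>r<k. \<sigma>1 r = \<sigma> r"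
      using F(2)[of \<sigma>] by auto
    then show ?thesis
      using G(2)[of \<sigma>1] Some by (auto simp: pf_comp_def yields_def split: option.splits)
  qed
  then show "\<exists>F. computable F \<and> (\<forall>\<sigma>. yields k out F \<sigma> (pf_comp g hs (map \<sigma> is)))"
    using computable_seq[OF F(1) G(1)] by blast
qed

section \<open>Primitive recursion\<close>

text \<open>Every stage uses the previous value, so undefinedness propagates upwards. This justifies
  a program that diverges at the first undefined stage.\<close>

lemma pf_rec_at_undefined:
  assumes "pf_rec_at g h m xs = None" "m \<le> d"
  shows "pf_rec_at g h d xs = None"
  using assms(2,1) by (induction d rule: dec_induct) auto

text \<open>The counter \<open>?c\<close> runs upwards from 0 while \<open>out\<close> holds the
  recursion's value at \<open>?c\<close>; the loop stops when \<open>?c\<close> equals the input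
  \<open>i\<close>, so neither predecessor nor order test is required. The value of \<open>h\<close>
  goes through \<open>?t\<close>, since \<open>out\<close> is itself an argument of
  \<open>h\<close>.\<close>

lemma implementable_prec:
  assumes g: "implementable n g" and h: "implementable (n + 2) h"
  shows "implementable (n + 1) (pf_rec g h)"
  unfolding implementable_def
proof (intro allI impI, elim conjE)
  fix k out :: nat and "is" :: "nat list"
  assume l: "register_layout k out is" "length is = n + 1"
  then obtain i js where js: "is = i # js" "length js = n" by (cases "is") auto
  have i: "i < k" "i \<noteq> C" "i \<noteq> out" and k: "C < k" "out < k" "out \<noteq> C"
    and js': "\<And>r. r \<in> set js \<Longrightarrow> r < k \<and> r \<noteq> out \<and> r \<noteq> C"
    using l js by (auto simp: register_layout_def)
  let ?c = k and ?t = "Suc k" and ?k = "Suc (Suc k)"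
  have "register_layout ?k out js"
    using k js' by (fastforce simp: register_layout_def)
  then obtain G where G: "computable G" "\<And>\<sigma>. yields ?k out G \<sigma> (g (map \<sigma> js))"
    using implementableD[OF g _ js(2)] by blast
  have "register_layout ?k ?t (?c # out # js)"
    using k js' by (fastforce simp: register_layout_def)
  then obtain H where H: "computable H"
    "\<And>\<sigma>. yields ?k ?t H \<sigma> (h (map \<sigma> (?c # out # js)))"
    using implementableD[OF h, of ?k ?t "?c # out # js"] js(2)
    by (metis add_2_eq_Suc' length_Cons)
  define body where "body = (\<lambda>\<sigma>. Option.bind (H \<sigma>) (\<lambda>\<sigma>. Option.bind (Some (\<sigma>(out := \<sigma> ?t)))
    (\<lambda>\<sigma>. Some (\<sigma>(?c := Suc (\<sigma> ?c))))))"
  have body: "computable body"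
    unfolding body_def using H(1) k
    by (intro computable_seq computable_copy computable_suc) auto
  \<comment> \<open>Here \<open>d\<close> counts the remaining rounds; the second premise is the
    loop invariant.\<close>
  have iterate: "yields k out (loop ?c i body) \<sigma> (pf_rec_at g h (\<sigma> i) (map \<sigma> js))"
    if "\<sigma> i = \<sigma> ?c + d" "pf_rec_at g h (\<sigma> ?c) (map \<sigma> js) = Some (\<sigma> out)" for \<sigma> d
    using that
  proof (induction d arbitrary: \<sigma>)
    case 0
    then show ?case by (simp add: loop_exit yields_Some)
  next
    case (Suc d)
    let ?xs = "map \<sigma> js"
    have loop: "loop ?c i body \<sigma> = Option.bind (body \<sigma>) (loop ?c i body)"
      using Suc.prems(1) by (intro loop_continue) simp
    have next_val: "pf_rec_at g h (Suc (\<sigma> ?c)) ?xs = h (map \<sigma> (?c # out # js))"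
      using Suc.prems(2) by simp
    show ?case
    proof (cases "h (map \<sigma> (?c # out # js))")
      case None
      then have "H \<sigma> = None" using H(2)[of \<sigma>] by (simp add: yields_None)
      moreover have "pf_rec_at g h (\<sigma> i) ?xs = None"
      proof (rule pf_rec_at_undefined)
        show "pf_rec_at g h (Suc (\<sigma> ?c)) ?xs = None" using next_val None by (simp only:)
      qed (simp add: Suc.prems(1))
      ultimately show ?thesis using loop by (simp add: body_def yields_None)
    next
      case (Some m)
      then obtain \<sigma>1 where \<sigma>1: "H \<sigma> = Some \<sigma>1" "\<sigma>1 ?t = m" "\<forall>r<?k. r \<noteq> ?t \<longrightarrow> \<sigma>1 r = \<sigma> r"
        using H(2)[of \<sigma>] by (auto simp only: yields_Some)
      define \<sigma>2 where "\<sigma>2 = \<sigma>1(out := m, ?c := Suc (\<sigma> ?c))"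
      have body2: "body \<sigma> = Some \<sigma>2"
        using \<sigma>1 k by (simp add: body_def \<sigma>2_def)
      have frame: "\<sigma>2 r = \<sigma> r" if "r < k" "r \<noteq> out" for r
        using that \<sigma>1(3) by (simp add: \<sigma>2_def)
      have xs: "map \<sigma>2 js = ?xs" using frame js' by auto
      have "\<sigma>2 ?c = Suc (\<sigma> ?c)" "\<sigma>2 out = m" using k by (auto simp: \<sigma>2_def)
      moreover have "\<sigma>2 i = \<sigma> i" using frame i by simp
      ultimately have "yields k out (loop ?c i body) \<sigma>2 (pf_rec_at g h (\<sigma> i) ?xs)"
        using Suc.IH[of \<sigma>2] Suc.prems(1) Some next_val unfolding xs by simp
      then show ?thesis
        using loop body2 frame by (auto simp: yields_def split: option.splits)
    qed
  qed
  let ?F = "\<lambda>\<sigma>. Option.bind (Some (\<sigma>(?c := 0))) (\<lambda>\<sigma>. Option.bind (G \<sigma>) (loop ?c i body))"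
  have "computable ?F"
    using k i G(1) body by (intro computable_seq computable_zero computable_loop) auto
  moreover have "yields k out ?F \<sigma> (pf_rec g h (map \<sigma> is))" for \<sigma>
  proof -
    let ?\<sigma> = "\<sigma>(?c := 0)"
    have args: "map ?\<sigma> js = map \<sigma> js" using js' by auto
    have val: "pf_rec g h (map \<sigma> is) = pf_rec_at g h (\<sigma> i) (map \<sigma> js)"
      by (simp add: pf_rec_def js)
    show ?thesis
    proof (cases "g (map \<sigma> js)")
      case None
      then show ?thesis
        using G(2)[of ?\<sigma>] pf_rec_at_undefined[of g h 0] unfolding args val
        by (simp add: yields_None)
    next
      case (Some m)
      then obtain \<sigma>1 where \<sigma>1: "G ?\<sigma> = Some \<sigma>1" "\<sigma>1 out = m" "\<forall>r<?k. r \<noteq> out \<longrightarrow> \<sigma>1 r = ?\<sigma> r"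
        using G(2)[of ?\<sigma>] unfolding args by (auto simp only: yields_Some)
      have frame: "\<sigma>1 r = \<sigma> r" if "r < k" "r \<noteq> out" for r
        using that \<sigma>1(3) by simp
      have xs: "map \<sigma>1 js = map \<sigma> js" using frame js' by auto
      have "\<sigma>1 ?c = 0" "\<sigma>1 i = \<sigma> i" using \<sigma>1(3) k frame i by auto
      then have "yields k out (loop ?c i body) \<sigma>1 (pf_rec_at g h (\<sigma> i) (map \<sigma> js))"
        using iterate[of \<sigma>1 "\<sigma> i"] \<sigma>1(2) Some unfolding xs by simp
      then show ?thesis
        using \<sigma>1(1) frame unfolding val by (auto simp: yields_def split: option.splits)
    qed
  qed
  ultimately show "\<exists>F. computable F \<and> (\<forall>\<sigma>. yields k out F \<sigma> (pf_rec g h (map \<sigma> is)))" by blast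
qed

section \<open>Minimisation\<close>

text \<open>For \<open>a < b\<close> the value of \<open>h\<close> at \<open>a\<close> would be both
  zero and positive. This gives uniqueness of the minimum, and it keeps the search from running past
  it.\<close>

lemma is_mu_le:
  assumes "is_mu h xs a" "\<forall>i<b. \<exists>r>0. h (i # xs) = Some r"
  shows "b \<le> a"
  using assms unfolding is_mu_def by (metis leI option.inject less_irrefl)

lemma pf_mu_eq:
  assumes "is_mu h xs m"
  shows "pf_mu h xs = Some m"
proof -
  have "m' = m" if "is_mu h xs m'" for m'
    using is_mu_le[OF assms, of m'] is_mu_le[OF that, of m] assms that
    by (simp add: is_mu_def)
  then have "(THE k. is_mu h xs k) = m" using assms by blast
  then show ?thesis using assms by (auto simp: pf_mu_def)
qed

text \<open>Register \<open>?z\<close> stays 0, because a test for zero is only available as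
  equality of two registers. The loop tests before its body, so \<open>h\<close> is evaluated at 0
  beforehand and the body increments the counter before evaluating \<open>h\<close> again.\<close>

lemma implementable_mu:
  assumes h: "implementable (n + 1) h"
  shows "implementable n (pf_mu h)"
  unfolding implementable_def
proof (intro allI impI, elim conjE)
  fix k out :: nat and "is" :: "nat list"
  assume l: "register_layout k out is" "length is = n"
  have k: "C < k" "out < k" "out \<noteq> C"
    and is': "\<And>r. r \<in> set is \<Longrightarrow> r < k \<and> r \<noteq> out \<and> r \<noteq> C"
    using l by (auto simp: register_layout_def)
  let ?c = k and ?z = "k + 1" and ?t = "k + 2" and ?k = "k + 3"
  have "register_layout ?k ?t (?c # is)"
    using k is' by (fastforce simp: register_layout_def)
  then obtain H where H: "computable H" "\<And>\<sigma>. yields ?k ?t H \<sigma> (h (map \<sigma> (?c # is)))"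
    using implementableD[OF h, of ?k ?t "?c # is"] l(2)
    by (metis Suc_eq_plus1 length_Cons)
  define body where "body = (\<lambda>\<sigma>. Option.bind (Some (\<sigma>(?c := Suc (\<sigma> ?c)))) H)"
  define F where "F = (\<lambda>\<sigma>. Option.bind (Some (\<sigma>(?c := 0))) (\<lambda>\<sigma>. Option.bind (Some (\<sigma>(?z := 0)))
    (\<lambda>\<sigma>. Option.bind (H \<sigma>) (\<lambda>\<sigma>. Option.bind (loop ?t ?z body \<sigma>) (\<lambda>\<sigma>. Some (\<sigma>(out := \<sigma> ?c)))))))"
  have "computable F"
    unfolding F_def body_def using k H(1)
    by (intro computable_seq computable_zero computable_loop computable_suc computable_copy) auto
  moreover have "yields k out F \<sigma>0 (pf_mu h (map \<sigma>0 is))" for \<sigma>0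
  proof -
    define xs where "xs = map \<sigma>0 is"
    \<comment> \<open>On exit \<open>?t\<close> equals \<open>?z\<close>, hence 0, and the invariant
      becomes \<open>is_mu\<close> at the counter.\<close>
    define Inv where "Inv \<sigma> \<longleftrightarrow> \<sigma> ?z = 0 \<and> h (\<sigma> ?c # xs) = Some (\<sigma> ?t) \<and>
      (\<forall>i<\<sigma> ?c. \<exists>r>0. h (i # xs) = Some r) \<and> (\<forall>r<k. \<sigma> r = \<sigma>0 r)" for \<sigma>
    have args: "map \<sigma> (?c # is) = \<sigma> ?c # xs" if "\<forall>r<k. \<sigma> r = \<sigma>0 r" for \<sigma>
      using that is' by (auto simp: xs_def)
    have H': "yields ?k ?t H \<sigma> (h (\<sigma> ?c # xs))" if "\<forall>r<k. \<sigma> r = \<sigma>0 r" for \<sigma>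
      using H(2)[of \<sigma>] args[OF that] by simp
    have step: "case h (Suc (\<sigma> ?c) # xs) of None \<Rightarrow> body \<sigma> = None
        | Some m \<Rightarrow> \<exists>\<sigma>'. body \<sigma> = Some \<sigma>' \<and> Inv \<sigma>' \<and> \<sigma>' ?c = Suc (\<sigma> ?c)"
      if "Inv \<sigma>" "\<sigma> ?t \<noteq> \<sigma> ?z" for \<sigma>
    proof -
      let ?\<sigma> = "\<sigma>(?c := Suc (\<sigma> ?c))"
      have y: "yields ?k ?t H ?\<sigma> (h (Suc (\<sigma> ?c) # xs))"
        using H'[of ?\<sigma>] that(1) by (simp add: Inv_def)
      show ?thesis
      proof (cases "h (Suc (\<sigma> ?c) # xs)")
        case None
        then show ?thesis using y by (simp add: yields_None body_def)
      next
        case (Some m)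
        then obtain \<sigma>1 where \<sigma>1: "H ?\<sigma> = Some \<sigma>1" "\<sigma>1 ?t = m" "\<forall>r<?k. r \<noteq> ?t \<longrightarrow> \<sigma>1 r = ?\<sigma> r"
          using y by (auto simp only: yields_Some)
        have "\<sigma>1 ?c = Suc (\<sigma> ?c)" "\<sigma>1 ?z = 0" "\<forall>r<k. \<sigma>1 r = \<sigma>0 r"
          using \<sigma>1(3) that(1) by (auto simp: Inv_def)
        \<comment> \<open>The failed test says that the value at the old counter is nonzero; this
          extends the range of positive values by one.\<close>
        then have "Inv \<sigma>1"
          using that Some \<sigma>1(2) by (auto simp: Inv_def less_Suc_eq)
        then show ?thesis
          using Some \<sigma>1(1) \<open>\<sigma>1 ?c = Suc (\<sigma> ?c)\<close> by (simp add: body_def)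
      qed
    qed
    have sound: "is_mu h xs (\<tau> ?c) \<and> (\<forall>r<k. \<tau> r = \<sigma>0 r)"
      if "loop ?t ?z body \<sigma> = Some \<tau>" "Inv \<sigma>" for \<sigma> \<tau>
    proof -
      have "Inv \<sigma>'" if "Inv \<sigma>" "\<sigma> ?t \<noteq> \<sigma> ?z" "body \<sigma> = Some \<sigma>'" for \<sigma> \<sigma>'
        using step[OF that(1,2)] that(3) by (cases "h (Suc (\<sigma> ?c) # xs)") auto
      then have "Inv \<tau> \<and> \<tau> ?t = \<tau> ?z"
        using loop_invariant[of ?t ?z body \<sigma> \<tau> Inv] that by blast
      then show ?thesis by (auto simp: Inv_def is_mu_def)
    qed
    \<comment> \<open>The distance to the minimum \<open>m\<close> is the measure: the counter
      cannot pass \<open>m\<close>, and at \<open>m\<close> the test succeeds.\<close>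
    have complete: "loop ?t ?z body \<sigma> \<noteq> None" if "Inv \<sigma>" "is_mu h xs m" for \<sigma> m
      using that(1)
    proof (induction "m - \<sigma> ?c" arbitrary: \<sigma> rule: less_induct)
      case less
      show ?case
      proof (cases "\<sigma> ?t = \<sigma> ?z")
        case True
        then show ?thesis by (simp add: loop_exit)
      next
        case False
        have "\<sigma> ?c \<le> m"
          using is_mu_le[OF that(2)] less.prems by (auto simp: Inv_def)
        moreover have "\<sigma> ?c \<noteq> m"
          using that(2) less.prems False by (auto simp: Inv_def is_mu_def)
        ultimately have lt: "\<sigma> ?c < m" by simp
        then have "h (Suc (\<sigma> ?c) # xs) \<noteq> None"
          using that(2) Suc_lessI[OF lt] unfolding is_mu_def by (metis option.distinct(1))
        then obtain \<sigma>' where \<sigma>': "body \<sigma> = Some \<sigma>'" "Inv \<sigma>'" "\<sigma>' ?c = Suc (\<sigma> ?c)"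
          using step[OF less.prems False] by auto
        then have "loop ?t ?z body \<sigma>' \<noteq> None"
          using lt by (intro less.hyps) auto
        then show ?thesis
          using loop_continue[of \<sigma> ?t ?z body] False \<sigma>'(1) by simp
      qed
    qed
    let ?\<sigma> = "\<sigma>0(?c := 0, ?z := 0)"
    have y: "yields ?k ?t H ?\<sigma> (h (0 # xs))"
      using H'[of ?\<sigma>] by simp
    show ?thesis
      unfolding xs_def[symmetric]
    proof (cases "h (0 # xs)")
      case None
      \<comment> \<open>Every candidate minimum requires \<open>h\<close> to be defined at 0, either
        as the zero itself or as an earlier positive value.\<close>
      then have "\<not> is_mu h xs m" for m by (cases m) (auto simp: is_mu_def)
      then have "pf_mu h xs = None" by (simp add: pf_mu_def)
      then show "yields k out F \<sigma>0 (pf_mu h xs)"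
        using y None by (simp add: F_def yields_None)
    next
      case (Some m)
      then obtain \<sigma>1 where \<sigma>1: "H ?\<sigma> = Some \<sigma>1" "\<sigma>1 ?t = m" "\<forall>r<?k. r \<noteq> ?t \<longrightarrow> \<sigma>1 r = ?\<sigma> r"
        using y by (auto simp only: yields_Some)
      have "\<sigma>1 ?c = 0" "\<sigma>1 ?z = 0" "\<forall>r<k. \<sigma>1 r = \<sigma>0 r"
        using \<sigma>1(3) by auto
      then have inv: "Inv \<sigma>1" using Some \<sigma>1(2) by (simp add: Inv_def)
      show "yields k out F \<sigma>0 (pf_mu h xs)"
      proof (cases "loop ?t ?z body \<sigma>1")
        case None
        then have "\<not> is_mu h xs m" for m using complete[OF inv] by blast
        then have "pf_mu h xs = None" by (simp add: pf_mu_def)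
        then show ?thesis using \<sigma>1(1) None by (simp add: F_def yields_None)
      next
        case (Some \<tau>)
        then show ?thesis
          using sound[OF Some inv] \<sigma>1(1) by (auto simp: pf_mu_eq F_def yields_Some)
      qed
    qed
  qed
  ultimately show "\<exists>F. computable F \<and> (\<forall>\<sigma>. yields k out F \<sigma> (pf_mu h (map \<sigma> is)))" by blast
qed

section \<open>From partial recursive functions to processes\<close>

lemma partial_recursive_implementable:
  assumes "partial_recursive n f"
  shows "implementable n f"
  using assms
proof induction
  case (comp hs g n)
  then show ?case by (intro implementable_comp) auto
qed (auto intro: implementable_zero implementable_succ[unfolded One_nat_def] implementable_proj
    implementable_prec[simplified] implementable_mu[simplified] implementable_cong)

end

theorem mainTheorem7:
  fixes n :: nat and f :: "nat list \<Rightarrow> nat option" and x y :: 'v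
  assumes "x \<noteq> y"
    and "partial_recursive n f"
  shows "\<exists>P :: 'v program. network_wf (snd P) \<and> implements x P f [1..<n + 1] 0"
proof -
  \<comment> \<open>Processes \<open>0\<close> to \<open>n\<close> are the output and the inputs,
    and they serve as registers themselves; the controller is the next process, and scratch
    registers start at \<open>n + 2\<close>.\<close>
  interpret controller "n + 1" x y using assms(1) by unfold_locales
  have "register_layout (n + 2) 0 [1..<n + 1]" unfolding register_layout_def by auto
  then obtain F where F: "computable F"
    "\<And>\<sigma>. yields (n + 2) 0 F \<sigma> (f (map \<sigma> [1..<n + 1]))"
    using implementableD[OF partial_recursive_implementable[OF assms(2)], of "n + 2" 0 "[1..<n + 1]"]
    by (metis add_diff_cancel_right' length_upt)
  obtain P where P: "network_wf (snd P)" "\<And>s. case F (\<lambda>r. s r x) of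
      None \<Rightarrow> no_execution_terminates (P, s)
    | Some \<sigma>' \<Rightarrow> all_executions_terminate_in (P, s) (\<lambda>s'. \<forall>r. r \<noteq> n + 1 \<longrightarrow> s' r x = \<sigma>' r)"
    using computable_program[OF F(1)] by blast
  have "case f ns of
      Some m \<Rightarrow> all_executions_terminate_in (P, s) (\<lambda>s'. s' 0 x = m)
    | None \<Rightarrow> no_execution_terminates (P, s)"
    if ns: "length ns = length [1..<n + 1]"
      "\<forall>i<length [1..<n + 1]. s ([1..<n + 1] ! i) x = ns ! i" for s ns
  proof -
    have "map (\<lambda>r. s r x) [1..<n + 1] = ns"
      using ns by (intro nth_equalityI) auto
    then have y: "yields (n + 2) 0 F (\<lambda>r. s r x) (f ns)"
      using F(2)[of "\<lambda>r. s r x"] by simp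
    show ?thesis
    proof (cases "f ns")
      case None
      then show ?thesis using y P(2)[of s] by (simp add: yields_None)
    next
      case (Some m)
      then obtain \<sigma>' where "F (\<lambda>r. s r x) = Some \<sigma>'" "\<sigma>' 0 = m"
        using y by (auto simp: yields_Some)
      then show ?thesis
        using P(2)[of s] Some by (auto simp: all_executions_terminate_in_def)
    qed
  qed
  then have "implements x P f [1..<n + 1] 0" unfolding implements_def by blast
  then show ?thesis using P(1) by blast
qed

end
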